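(* Let $\mu=\mu^{\mathrm{RC}}_{E,\boldsymbol p,\boldsymbol\lambda}$ be the distribution of the random cluster model specified by a graph $G=(V,E)$ and parameters $\boldsymbol p\in[0,1]^E$ and $\boldsymbol\lambda\in[0,1)^V$, and let $\lambda_{\max}=\max_{v\in V}\lambda_v$. Then $\mu$ is $2(1-\lambda_{\max})^{-2}$-spectrally independent.
   Context: Graphs are finite, undirected and simple. The random cluster model is the distribution over subsets $S\subseteq E$ with $\mu^{\mathrm{RC}}_{E,\boldsymbol p,\boldsymbol\lambda}(S)=w(S)/\sum_{T\subseteq E}w(T)$, where $$w(S)=\prod_{e\in S}p_e\prod_{f\in E\setminus S}(1-p_f)\prod_{C\in\kappa(V,S)}\Bigl(1+\prod_{j\in C}\lambda_j\Bigr),$$ and $\kappa(V,S)$ is the set of connected components (as vertex sets) of $(V,S)$. For a distribution $\mu$ over $2^U$ ($U$ finite), $\mu(j\mid i)=\Pr_{S\sim\mu}[j\in S\mid i\in S]$ and $\mu(j\mid\overline i)=\Pr_{S\sim\mu}[j\in S\mid i\notin S]$. The influence matrix $\Psi^{\mathrm{inf}}_\mu\in\mathbb R^{U\times U}$ has entries $\Psi^{\mathrm{inf}}_\mu(i,j)=\mu(j\mid i)-\mu(j\mid\overline i)$ if $i\ne j$ and $0<\Pr_{S\sim\mu}[i\in S]<1$, and $0$ otherwise. The distribution $\mu$ is $C$-spectrally independent if $\|\Psi^{\mathrm{inf}}_\mu\|_\infty=\max_{i\in U}\sum_{j\in U}|\Psi^{\mathrm{inf}}_\mu(i,j)|\le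 C$. *)

theory Defs
  imports "HOL-Probability.Probability_Mass_Function"
begin

definition simple_graph :: "'v set \<Rightarrow> 'v set set \<Rightarrow> bool" where
  "simple_graph V E \<longleftrightarrow> finite V \<and> (\<forall>e\<in>E. e \<subseteq> V \<and> card e = 2)"

definition connected_by :: "'v set \<Rightarrow> 'v set set \<Rightarrow> 'v rel" where
  "connected_by V S = {(u, v). u \<in> V \<and> v \<in> V \<and> (u, v) \<in> {(x, y). {x, y} \<in> S}\<^sup>*}"

text \<open>Vertex sets of the components of \<open>(V, S)\<close>; isolated vertices give singleton components.\<close>

definition components_of_graph :: "'v set \<Rightarrow> 'v set set \<Rightarrow> 'v set set" where
  "components_of_graph V S = V // connected_by V S"

definition rc_weight ::
    "'v set \<Rightarrow> 'v set set \<Rightarrow> ('v set \<Rightarrow> real) \<Rightarrow> ('v \<Rightarrow> real) \<Rightarrow> 'v set set \<Rightarrow> real" where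
  "rc_weight V E p lam S =
     (\<Prod>e\<in>S. p e) * (\<Prod>f\<in>E - S. 1 - p f) *
     (\<Prod>C\<in>components_of_graph V S. 1 + (\<Prod>j\<in>C. lam j))"

definition rc_partition ::
    "'v set \<Rightarrow> 'v set set \<Rightarrow> ('v set \<Rightarrow> real) \<Rightarrow> ('v \<Rightarrow> real) \<Rightarrow> real" where
  "rc_partition V E p lam = (\<Sum>T\<in>Pow E. rc_weight V E p lam T)"

text \<open>
  For parameters in the ranges of the model, the function given to \<^const>\<open>embed_pmf\<close> is a
  probability mass function; see \<open>pmf_random_cluster\<close> below.
\<close>

definition random_cluster ::
    "'v set \<Rightarrow> 'v set set \<Rightarrow> ('v set \<Rightarrow> real) \<Rightarrow> ('v \<Rightarrow> real) \<Rightarrow> 'v set set pmf" where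
  "random_cluster V E p lam =
     embed_pmf (\<lambda>S. if S \<subseteq> E then rc_weight V E p lam S / rc_partition V E p lam else 0)"

definition influence_matrix :: "'u set pmf \<Rightarrow> 'u \<Rightarrow> 'u \<Rightarrow> real" where
  "influence_matrix \<mu> i j =
     (if i \<noteq> j \<and> 0 < \<P>(S in \<mu>. i \<in> S) \<and> \<P>(S in \<mu>. i \<in> S) < 1
      then \<P>(S in \<mu>. j \<in> S \<bar> i \<in> S) - \<P>(S in \<mu>. j \<in> S \<bar> i \<notin> S)
      else 0)"

text \<open>
  The maximum absolute row sum over a finite index set. Inserting \<open>0\<close> only fixes the value
  for the empty index set.
\<close>

definition matrix_inf_norm :: "'u set \<Rightarrow> ('u \<Rightarrow> 'u \<Rightarrow> real) \<Rightarrow> real" where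
  "matrix_inf_norm U A = Max (insert 0 ((\<lambda>i. \<Sum>j\<in>U. \<bar>A i j\<bar>) ` U))"

text \<open>Here \<open>\<mu>\<close> is a distribution on the subsets of the finite set \<open>U\<close>.\<close>

definition spectrally_independent :: "'u set \<Rightarrow> 'u set pmf \<Rightarrow> real \<Rightarrow> bool" where
  "spectrally_independent U \<mu> C \<longleftrightarrow> matrix_inf_norm U (influence_matrix \<mu>) \<le> C"

lemma simple_graph_finite_edges: "simple_graph V E \<Longrightarrow> finite E"
  unfolding simple_graph_def by (meson PowI finite_Pow_iff finite_subset subsetI)

lemma component_subset: "C \<in> components_of_graph V S \<Longrightarrow> C \<subseteq> V"
  by (auto simp: components_of_graph_def connected_by_def quotient_def)

lemma rc_component_factor_ge_1:
  assumes "\<forall>v\<in>V. lam v \<in> {0..<1::real}"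
  shows "1 \<le> (\<Prod>C\<in>components_of_graph V S. 1 + (\<Prod>j\<in>C. lam j))"
proof (rule prod_ge_1)
  fix C assume "C \<in> components_of_graph V S"
  then have "\<And>j. j \<in> C \<Longrightarrow> 0 \<le> lam j"
    using assms component_subset by fastforce
  then show "1 \<le> 1 + (\<Prod>j\<in>C. lam j)"
    by (simp add: prod_nonneg)
qed

lemma rc_edge_factor_nonneg:
  assumes "\<forall>e\<in>E. p e \<in> {0..1::real}" "S \<subseteq> E"
  shows "0 \<le> (\<Prod>e\<in>S. p e) * (\<Prod>f\<in>E - S. 1 - p f)"
  using assms by (intro mult_nonneg_nonneg prod_nonneg) auto

lemma rc_weight_nonneg:
  assumes "\<forall>e\<in>E. p e \<in> {0..1}" "\<forall>v\<in>V. lam v \<in> {0..<1}" "S \<subseteq> E"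
  shows "0 \<le> rc_weight V E p lam S"
  unfolding rc_weight_def
  using rc_component_factor_ge_1[OF assms(2), of S]
  by (intro mult_nonneg_nonneg[OF rc_edge_factor_nonneg[OF assms(1,3)]]) simp

lemma rc_partition_pos:
  assumes "simple_graph V E" "\<forall>e\<in>E. p e \<in> {0..1}" "\<forall>v\<in>V. lam v \<in> {0..<1}"
  shows "0 < rc_partition V E p lam"
proof -
  have fin: "finite E" using assms(1) by (rule simple_graph_finite_edges)
  have "1 = (\<Prod>e\<in>E. p e + (1 - p e))" by simp
  also have "\<dots> = (\<Sum>T\<in>Pow E. (\<Prod>e\<in>T. p e) * (\<Prod>f\<in>E - T. 1 - p f))"
    by (rule prod_add[OF fin])
  also have "\<dots> \<le> rc_partition V E p lam"
    unfolding rc_partition_def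
  proof (rule sum_mono)
    fix T assume "T \<in> Pow E"
    then show "(\<Prod>e\<in>T. p e) * (\<Prod>f\<in>E - T. 1 - p f) \<le> rc_weight V E p lam T"
      using mult_left_mono[OF rc_component_factor_ge_1[OF assms(3), of T]
          rc_edge_factor_nonneg[OF assms(2), of T]]
      by (simp add: rc_weight_def)
  qed
  finally show ?thesis by simp
qed

lemma pmf_random_cluster:
  assumes "simple_graph V E" "\<forall>e\<in>E. p e \<in> {0..1}" "\<forall>v\<in>V. lam v \<in> {0..<1}"
  shows "pmf (random_cluster V E p lam) S =
           (if S \<subseteq> E then rc_weight V E p lam S / rc_partition V E p lam else 0)"
proof -
  let ?f = "\<lambda>S. if S \<subseteq> E then rc_weight V E p lam S / rc_partition V E p lam else 0"
  have fin: "finite (Pow E)" using simple_graph_finite_edges[OF assms(1)] by simp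
  have pos: "0 < rc_partition V E p lam" by (rule rc_partition_pos[OF assms])
  have nonneg: "0 \<le> ?f S" for S
    using rc_weight_nonneg[OF assms(2,3)] pos by simp
  have "(\<integral>\<^sup>+ S. ennreal (?f S) \<partial>count_space UNIV) = (\<Sum>S\<in>Pow E. ennreal (?f S))"
    by (rule nn_integral_count_space'[OF fin]) auto
  also have "\<dots> = ennreal (\<Sum>S\<in>Pow E. ?f S)"
    by (rule sum_ennreal) (rule nonneg)
  also have "(\<Sum>S\<in>Pow E. ?f S) = (\<Sum>S\<in>Pow E. rc_weight V E p lam S / rc_partition V E p lam)"
    by (rule sum.cong) auto
  also have "\<dots> = 1"
    using pos by (simp add: sum_divide_distrib[symmetric] rc_partition_def[symmetric])
  finally show ?thesis
    unfolding random_cluster_def using nonneg by (subst pmf_embed_pmf) auto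
qed

lemma set_pmf_random_cluster:
  assumes "simple_graph V E" "\<forall>e\<in>E. p e \<in> {0..1}" "\<forall>v\<in>V. lam v \<in> {0..<1}"
  shows "set_pmf (random_cluster V E p lam) \<subseteq> Pow E"
  by (auto simp: set_pmf_iff pmf_random_cluster[OF assms] split: if_splits)

end

theory Submission
  imports Defs
begin

text \<open>
  Summing over spins rewrites the random cluster weights as a high-temperature expansion: a sum over
  edge sets \<open>S\<close> in which every vertex of odd degree in \<open>S\<close> costs \<open>\<eta> v = (1 - lam v) / (1 + lam v)\<close>.
  The row of the influence matrix at \<open>e = {u, v}\<close> is then bounded by the difference of the edge marginals
  of this model and of the model whose odd set is shifted by \<open>e\<close>, that is, by shifts at two single
  vertices. A shift at one vertex is analysed by a coupling in which the discrepancy is a single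
  walker: revealing an edge at its position either leaves the walker in place or moves it along that
  edge. On its first visit to a vertex it survives with probability at most
  \<open>(1 - \<eta> v) / (1 + \<eta> v) = lam v\<close>, hence it visits geometrically many vertices. Since it uses each edge
  at most once, it traverses at most \<open>(1 - \<lambda>)\<^sup>-\<^sup>2\<close> edges on average, where \<open>\<lambda>\<close> is the largest parameter.
\<close>

section \<open>The high-temperature weights: splitting at an edge and at a vertex\<close>

text \<open>
  \<open>A\<close> shifts the set of odd-degree vertices; \<open>\<eta> v = 0\<close> forces the parity at \<open>v\<close>. The sum
  \<open>edge_sum\<close> below is the part of \<open>parity_sum\<close> over the sets containing \<open>g\<close>.
\<close>

definition parity_sum ::
    "'v set \<Rightarrow> ('v set \<Rightarrow> real) \<Rightarrow> ('v set \<Rightarrow> real) \<Rightarrow> ('v \<Rightarrow> real) \<Rightarrow> 'v set set \<Rightarrow> 'v set \<Rightarrow> real" where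
  "parity_sum V y z \<eta> E A =
     (\<Sum>S\<in>Pow E. (\<Prod>e\<in>S. y e) * (\<Prod>e\<in>E - S. z e) *
        (\<Prod>v\<in>V. if odd (card {e\<in>S. v \<in> e}) \<noteq> (v \<in> A) then \<eta> v else 1))"

definition edge_sum ::
    "'v set \<Rightarrow> ('v set \<Rightarrow> real) \<Rightarrow> ('v set \<Rightarrow> real) \<Rightarrow> ('v \<Rightarrow> real) \<Rightarrow> 'v set set \<Rightarrow> 'v set \<Rightarrow> 'v set \<Rightarrow> real" where
  "edge_sum V y z \<eta> E A g = y g * parity_sum V y z \<eta> (E - {g}) (sym_diff A g)"

text \<open>
  The \<open>\<ell>\<^sub>1\<close> distance of the edge marginals, multiplied by both partition functions: with forced
  parities these can vanish.
\<close>

definition discrepancy ::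
    "'v set \<Rightarrow> ('v set \<Rightarrow> real) \<Rightarrow> ('v set \<Rightarrow> real) \<Rightarrow> ('v \<Rightarrow> real) \<Rightarrow> 'v set set \<Rightarrow> 'v set \<Rightarrow> 'v set \<Rightarrow> real" where
  "discrepancy V y z \<eta> E A B =
     (\<Sum>g\<in>E. \<bar>edge_sum V y z \<eta> E A g * parity_sum V y z \<eta> E B
           - edge_sum V y z \<eta> E B g * parity_sum V y z \<eta> E A\<bar>)"

text \<open>A set replaces iterated updates \<open>\<eta>(v := 0)\<close>, so that an induction can
  let the set of visited vertices grow.\<close>

definition harden :: "'v set \<Rightarrow> ('v \<Rightarrow> real) \<Rightarrow> 'v \<Rightarrow> real" where
  "harden H \<eta> v = (if v \<in> H then 0 else \<eta> v)"

lemma sym_diff_right_comm: "sym_diff (sym_diff A B) C = sym_diff (sym_diff A C) B"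
  by auto

lemma sym_diff_cancel [simp]: "sym_diff (sym_diff A B) B = A"
  by auto

lemma sum_Pow_split:
  fixes h :: "'a set \<Rightarrow> real"
  assumes "finite E" "f \<in> E"
  shows "sum h (Pow E) = sum h (Pow (E - {f})) + (\<Sum>S\<in>Pow (E - {f}). h (insert f S))"
proof -
  let ?P = "Pow (E - {f})"
  have E: "Pow E = ?P \<union> insert f ` ?P"
    using assms(2) Pow_insert[of f "E - {f}"] by (simp add: insert_absorb)
  have inj: "inj_on (insert f) ?P"
    by (auto simp: inj_on_def)
  have "sum h (Pow E) = sum h ?P + sum h (insert f ` ?P)"
    unfolding E by (rule sum.union_disjoint) (use assms in auto)
  then show ?thesis
    by (simp add: sum.reindex[OF inj])
qed

text \<open>Adding \<open>f\<close> to an edge set flips the degree parity at the vertices of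
  \<open>f\<close>, which amounts to shifting the odd set by \<open>f\<close>.\<close>

lemma parity_sum_edge:
  assumes "finite E" "f \<in> E"
  shows "parity_sum V y z \<eta> E A =
    z f * parity_sum V y z \<eta> (E - {f}) A + y f * parity_sum V y z \<eta> (E - {f}) (sym_diff A f)"
proof -
  let ?w = "\<lambda>S A. \<Prod>v\<in>V. if odd (card {e\<in>S. v \<in> e}) \<noteq> (v \<in> A) then \<eta> v else 1"
  let ?h = "\<lambda>S. (\<Prod>e\<in>S. y e) * (\<Prod>e\<in>E - S. z e) * ?w S A"
  have out: "?h S = z f * ((\<Prod>e\<in>S. y e) * (\<Prod>e\<in>E - {f} - S. z e) * ?w S A)"
    if "S \<in> Pow (E - {f})" for S
  proof -
    have "E - S = insert f (E - {f} - S)" using that assms by auto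
    then have "(\<Prod>e\<in>E - S. z e) = z f * (\<Prod>e\<in>E - {f} - S. z e)"
      using assms by simp
    then show ?thesis by simp
  qed
  have inn: "?h (insert f S) =
      y f * ((\<Prod>e\<in>S. y e) * (\<Prod>e\<in>E - {f} - S. z e) * ?w S (sym_diff A f))"
    if "S \<in> Pow (E - {f})" for S
  proof -
    have fin: "finite S" "f \<notin> S" using that assms finite_subset by auto
    have "E - insert f S = E - {f} - S" by auto
    moreover have "?w (insert f S) A = ?w S (sym_diff A f)"
    proof (rule prod.cong[OF refl])
      fix v
      have "{e \<in> insert f S. v \<in> e} = (if v \<in> f then insert f {e\<in>S. v \<in> e} else {e\<in>S. v \<in> e})"
        by auto
      then have "card {e \<in> insert f S. v \<in> e} = card {e\<in>S. v \<in> e} + (if v \<in> f then 1 else 0)"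
        using fin by simp
      then show "(if odd (card {e \<in> insert f S. v \<in> e}) \<noteq> (v \<in> A) then \<eta> v else 1) =
          (if odd (card {e\<in>S. v \<in> e}) \<noteq> (v \<in> sym_diff A f) then \<eta> v else 1)"
        by auto
    qed
    ultimately show ?thesis using fin by simp
  qed
  show ?thesis
    unfolding parity_sum_def sum_Pow_split[OF assms, of ?h]
    by (simp only: sum_distrib_left sum.cong[OF refl out] sum.cong[OF refl inn])
qed

text \<open>With 0 at \<open>v\<close> only the edge sets with the parity prescribed there survive.
  Shifting by \<open>{v}\<close> prescribes the opposite parity, and the edge sets violating the
  original one carry the factor \<open>\<eta> v\<close>.\<close>

lemma parity_sum_vertex:
  assumes "finite V" "v \<in> V"
  shows "parity_sum V y z \<eta> E A =
    parity_sum V y z (\<eta>(v := 0)) E A + \<eta> v * parity_sum V y z (\<eta>(v := 0)) E (sym_diff A {v})"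
proof -
  let ?w = "\<lambda>\<eta> S A. \<Prod>v\<in>V. if odd (card {e\<in>S. v \<in> e}) \<noteq> (v \<in> A) then \<eta> v else (1::real)"
  let ?r = "\<lambda>S. \<Prod>v\<in>V - {v}. if odd (card {e\<in>S. v \<in> e}) \<noteq> (v \<in> A) then \<eta> v else (1::real)"
  have r: "?w \<eta>' S B = (if odd (card {e\<in>S. v \<in> e}) \<noteq> (v \<in> B) then \<eta>' v else 1) * ?r S"
    if "\<And>u. u \<noteq> v \<Longrightarrow> \<eta>' u = \<eta> u \<and> (u \<in> B \<longleftrightarrow> u \<in> A)" for \<eta>' S B
    using that by (subst prod.remove[OF assms]) (intro arg_cong2[where f = "(*)"] prod.cong refl, simp)
  have "?w \<eta> S A = ?w (\<eta>(v := 0)) S A + \<eta> v * ?w (\<eta>(v := 0)) S (sym_diff A {v})" for S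
    by (subst (1 2 3) r) auto
  then show ?thesis
    by (simp add: parity_sum_def sum_distrib_left sum.distrib [symmetric] algebra_simps)
qed

lemma parity_sum_nonneg:
  assumes "\<And>e. e \<in> E \<Longrightarrow> 0 \<le> y e" "\<And>e. e \<in> E \<Longrightarrow> 0 \<le> z e" "\<And>v. v \<in> V \<Longrightarrow> 0 \<le> \<eta> v"
  shows "0 \<le> parity_sum V y z \<eta> E A"
  unfolding parity_sum_def using assms
  by (intro sum_nonneg mult_nonneg_nonneg prod_nonneg) auto

text \<open>The term of the empty edge set is already positive; \<open>y\<close> may vanish, because
  \<open>p e = 0\<close> is allowed.\<close>

lemma parity_sum_pos:
  assumes "finite E" "\<And>e. e \<in> E \<Longrightarrow> 0 \<le> y e" "\<And>e. e \<in> E \<Longrightarrow> 0 < z e" "\<And>v. v \<in> V \<Longrightarrow> 0 < \<eta> v"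
  shows "0 < parity_sum V y z \<eta> E A"
  unfolding parity_sum_def
proof (rule sum_pos2[where i = "{}"])
  show "0 < (\<Prod>e\<in>{}. y e) * (\<Prod>e\<in>E - {}. z e) *
      (\<Prod>v\<in>V. if odd (card {e \<in> {}. v \<in> e}) \<noteq> (v \<in> A) then \<eta> v else 1)"
    using assms by (auto intro!: mult_pos_pos prod_pos)
  show "0 \<le> (\<Prod>e\<in>S. y e) * (\<Prod>e\<in>E - S. z e) *
      (\<Prod>v\<in>V. if odd (card {e \<in> S. v \<in> e}) \<noteq> (v \<in> A) then \<eta> v else 1)" if "S \<in> Pow E" for S
    using assms that by (intro mult_nonneg_nonneg prod_nonneg) (auto intro: less_imp_le)
qed (use assms in auto)

text \<open>The degree of \<open>v\<close> is always 0, but the odd set asks for an odd degree, and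
  a violation costs the factor \<open>\<eta> v = 0\<close>.\<close>

lemma parity_sum_eq_0:
  assumes "finite V" "v \<in> V" "v \<in> A" "\<eta> v = 0" "\<And>e. e \<in> E \<Longrightarrow> v \<notin> e"
  shows "parity_sum V y z \<eta> E A = 0"
  unfolding parity_sum_def
proof (rule sum.neutral, rule ballI)
  fix S assume "S \<in> Pow E"
  then have S: "{e\<in>S. v \<in> e} = {}" using assms(5) by auto
  have "(if odd (card {e\<in>S. v \<in> e}) \<noteq> (v \<in> A) then \<eta> v else 1) = 0"
    using assms(3,4) unfolding S by simp
  then have "(\<Prod>v\<in>V. if odd (card {e\<in>S. v \<in> e}) \<noteq> (v \<in> A) then \<eta> v else 1) = 0"
    using assms(1,2) by (intro prod_zero bexI[of _ v])
  then show "(\<Prod>e\<in>S. y e) * (\<Prod>e\<in>E - S. z e) *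
      (\<Prod>v\<in>V. if odd (card {e\<in>S. v \<in> e}) \<noteq> (v \<in> A) then \<eta> v else 1) = 0"
    by simp
qed

lemma parity_sum_cong:
  assumes "\<And>e. e \<in> E \<Longrightarrow> y e = y' e" "\<And>e. e \<in> E \<Longrightarrow> z e = z' e"
  shows "parity_sum V y z \<eta> E A = parity_sum V y' z' \<eta> E A"
  unfolding parity_sum_def using assms
  by (intro sum.cong[OF refl] arg_cong2[where f = "(*)"] prod.cong refl) auto

lemma edge_sum_edge:
  assumes "finite E" "f \<in> E" "g \<noteq> f"
  shows "edge_sum V y z \<eta> E A g =
    z f * edge_sum V y z \<eta> (E - {f}) A g + y f * edge_sum V y z \<eta> (E - {f}) (sym_diff A f) g"
proof -
  have "E - {g} - {f} = E - {f} - {g}" by auto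
  then show ?thesis
    unfolding edge_sum_def
    using parity_sum_edge[of "E - {g}" f V y z \<eta> "sym_diff A g"] assms
    by (simp add: sym_diff_right_comm[of A f g] algebra_simps)
qed

lemma edge_sum_vertex:
  assumes "finite V" "v \<in> V"
  shows "edge_sum V y z \<eta> E A g =
    edge_sum V y z (\<eta>(v := 0)) E A g + \<eta> v * edge_sum V y z (\<eta>(v := 0)) E (sym_diff A {v}) g"
  unfolding edge_sum_def
  by (subst parity_sum_vertex[OF assms]) (simp add: sym_diff_right_comm[of A "{v}" g] algebra_simps)

section \<open>Two configurations whose odd sets differ at one vertex\<close>

lemma discrepancy_commute: "discrepancy V y z \<eta> E A B = discrepancy V y z \<eta> E B A"
  unfolding discrepancy_def by (simp add: abs_minus_commute)

text \<open>
  Both configurations are mixtures of the same two laws with a forced parity at \<open>v\<close>;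
  the mixing weights differ by at most \<open>(1 - \<eta> v) / (1 + \<eta> v)\<close>.
\<close>

lemma discrepancy_soft_vertex:
  assumes "finite V" "v \<in> V" "0 \<le> \<eta> v" "\<eta> v \<le> 1" "1 - \<eta> v \<le> l * (1 + \<eta> v)"
    and nn: "\<And>A. 0 \<le> parity_sum V y z (\<eta>(v := 0)) E A"
    and "0 \<le> b"
    and hard: "discrepancy V y z (\<eta>(v := 0)) E A (sym_diff A {v}) \<le>
       b * (parity_sum V y z (\<eta>(v := 0)) E A * parity_sum V y z (\<eta>(v := 0)) E (sym_diff A {v}))"
  shows "discrepancy V y z \<eta> E A (sym_diff A {v}) \<le>
       l * b * (parity_sum V y z \<eta> E A * parity_sum V y z \<eta> E (sym_diff A {v}))"
proof -
  let ?\<eta> = "\<eta>(v := 0)" and ?B = "sym_diff A {v}" and ?h = "\<eta> v"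
  define P Q where "P = parity_sum V y z ?\<eta> E A" and "Q = parity_sum V y z ?\<eta> E ?B"
  have PQ: "0 \<le> P" "0 \<le> Q" using nn by (auto simp: P_def Q_def)
  have ZA: "parity_sum V y z \<eta> E A = P + ?h * Q"
    unfolding P_def Q_def by (rule parity_sum_vertex[OF assms(1,2)])
  have ZB: "parity_sum V y z \<eta> E ?B = Q + ?h * P"
    unfolding P_def Q_def by (subst parity_sum_vertex[OF assms(1,2)]) simp
  \<comment> \<open>With h for \<open>\<eta> v\<close>, both pairs arise from the forced ones by the
    matrix with rows (1, h) and (h, 1); its determinant 1 - h^2 comes out as a factor.\<close>
  have "edge_sum V y z \<eta> E A g * parity_sum V y z \<eta> E ?B - edge_sum V y z \<eta> E ?B g * parity_sum V y z \<eta> E A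
     = (1 - ?h\<^sup>2) * (edge_sum V y z ?\<eta> E A g * Q - edge_sum V y z ?\<eta> E ?B g * P)" for g
    unfolding ZA ZB
    by (subst (1 2) edge_sum_vertex[OF assms(1,2)]) (simp add: algebra_simps power2_eq_square)
  moreover have h2: "0 \<le> 1 - ?h\<^sup>2" using assms(3,4) by (simp add: power_le_one)
  ultimately have "discrepancy V y z \<eta> E A ?B = (1 - ?h\<^sup>2) * discrepancy V y z ?\<eta> E A ?B"
    unfolding discrepancy_def P_def[symmetric] Q_def[symmetric]
    by (simp add: abs_mult sum_distrib_left)
  also have "\<dots> \<le> (1 - ?h\<^sup>2) * (b * (P * Q))"
    using mult_left_mono[OF hard h2] by (simp add: P_def Q_def)
  \<comment> \<open>Only the factor 1 - h is spent on the hypothesis about \<open>l\<close>. The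
    resulting (1 + h)^2 is absorbed by the two mixed partition functions, whose product is smallest
    relative to \<open>P * Q\<close> when \<open>P = Q\<close>.\<close>
  also have "\<dots> = b * ((1 + ?h) * ((1 - ?h) * (P * Q)))"
    by (simp add: algebra_simps power2_eq_square)
  also have "\<dots> \<le> b * ((1 + ?h) * ((l * (1 + ?h)) * (P * Q)))"
    using assms PQ by (intro mult_left_mono mult_right_mono) auto
  also have "\<dots> = l * b * ((1 + ?h)\<^sup>2 * (P * Q))"
    by (simp add: power2_eq_square)
  also have "\<dots> \<le> l * b * ((P + ?h * Q) * (Q + ?h * P))"
  proof (rule mult_left_mono)
    have "(P + ?h * Q) * (Q + ?h * P) - (1 + ?h)\<^sup>2 * (P * Q) = ?h * (P - Q)\<^sup>2"
      by (simp add: algebra_simps power2_eq_square)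
    moreover have "0 \<le> ?h * (P - Q)\<^sup>2" using assms(3) by simp
    ultimately show "(1 + ?h)\<^sup>2 * (P * Q) \<le> (P + ?h * Q) * (Q + ?h * P)" by linarith
    have "0 \<le> l * (1 + ?h)" using assms(4,5) by linarith
    then have "0 \<le> l" using assms(3) by (simp add: zero_le_mult_iff)
    then show "0 \<le> l * b" using assms(7) by simp
  qed
  finally show ?thesis by (simp add: ZA ZB)
qed

text \<open>
  Revealing \<open>f\<close> independently in the two configurations: if the outcomes agree, the discrepancy
  stays at \<open>v\<close>, otherwise it moves along \<open>f\<close> to \<open>u\<close>.
\<close>

lemma discrepancy_edge_step:
  fixes V y z \<eta> E v u A
  defines "B \<equiv> sym_diff A {v}" and "f \<equiv> {v, u}"
  assumes "finite E" "f \<in> E" "v \<noteq> u"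
    and nn: "\<And>A. 0 \<le> parity_sum V y z \<eta> (E - {f}) A" "0 \<le> y f" "0 \<le> z f"
    and stay: "\<And>A. discrepancy V y z \<eta> (E - {f}) A (sym_diff A {v}) \<le>
       b * (parity_sum V y z \<eta> (E - {f}) A * parity_sum V y z \<eta> (E - {f}) (sym_diff A {v}))"
    and move: "\<And>A. discrepancy V y z \<eta> (E - {f}) A (sym_diff A {u}) \<le>
       (b - 1) * (parity_sum V y z \<eta> (E - {f}) A * parity_sum V y z \<eta> (E - {f}) (sym_diff A {u}))"
  shows "discrepancy V y z \<eta> E A B \<le> b * (parity_sum V y z \<eta> E A * parity_sum V y z \<eta> E B)"
proof -
  let ?E = "E - {f}"
  let ?Z = "parity_sum V y z \<eta> ?E" and ?N = "edge_sum V y z \<eta> ?E" and ?D = "discrepancy V y z \<eta> ?E"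
  define A1 B1 where "A1 = sym_diff A f" and "B1 = sym_diff B f"
  \<comment> \<open>If \<open>f\<close> is present in exactly one configuration, the shift by
    \<open>{v}\<close> combines with the shift by \<open>f\<close> to a shift by \<open>{u}\<close>:
    the walker has moved.\<close>
  have B1: "B1 = sym_diff A1 {v}" and AB1: "B1 = sym_diff A {u}" and BA1: "B = sym_diff A1 {u}"
    unfolding A1_def B1_def B_def f_def using assms(5) by auto
  have ZA: "parity_sum V y z \<eta> E A = z f * ?Z A + y f * ?Z A1"
    and ZB: "parity_sum V y z \<eta> E B = z f * ?Z B + y f * ?Z B1"
    unfolding A1_def B1_def by (rule parity_sum_edge[OF assms(3,4)])+
  define t where "t A B g = \<bar>?N A g * ?Z B - ?N B g * ?Z A\<bar>" for A B g
  have Dt: "?D A B = (\<Sum>g\<in>?E. t A B g)" for A B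
    by (simp add: discrepancy_def t_def)
  let ?T = "\<lambda>g. \<bar>edge_sum V y z \<eta> E A g * parity_sum V y z \<eta> E B - edge_sum V y z \<eta> E B g * parity_sum V y z \<eta> E A\<bar>"
  \<comment> \<open>The joint outcomes at \<open>f\<close> have weights z z (absent in both), y y
    (present in both) and z y (the two disagreements).\<close>
  have g: "?T g \<le> z f * z f * t A B g + y f * y f * t A1 B1 g + z f * y f * (t A B1 g + t A1 B g)"
    if "g \<in> ?E" for g
  proof -
    have NA: "edge_sum V y z \<eta> E A g = z f * ?N A g + y f * ?N A1 g"
      and NB: "edge_sum V y z \<eta> E B g = z f * ?N B g + y f * ?N B1 g"
      unfolding A1_def B1_def using that by (auto intro!: edge_sum_edge[OF assms(3,4)])
    have "?T g = \<bar>z f * z f * (?N A g * ?Z B - ?N B g * ?Z A) + y f * y f * (?N A1 g * ?Z B1 - ?N B1 g * ?Z A1)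
        + z f * y f * ((?N A g * ?Z B1 - ?N B1 g * ?Z A) + (?N A1 g * ?Z B - ?N B g * ?Z A1))\<bar>"
      unfolding NA NB ZA ZB by (rule arg_cong[where f = abs]) (simp add: algebra_simps)
    also have "\<dots> \<le> \<bar>z f * z f * (?N A g * ?Z B - ?N B g * ?Z A)\<bar> + \<bar>y f * y f * (?N A1 g * ?Z B1 - ?N B1 g * ?Z A1)\<bar>
        + \<bar>z f * y f * ((?N A g * ?Z B1 - ?N B1 g * ?Z A) + (?N A1 g * ?Z B - ?N B g * ?Z A1))\<bar>"
      by linarith
    also have "\<dots> \<le> z f * z f * t A B g + y f * y f * t A1 B1 g + z f * y f * (t A B1 g + t A1 B g)"
      unfolding t_def using nn(2,3) by (simp add: abs_mult mult_left_mono)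
    finally show ?thesis .
  qed
  \<comment> \<open>The edge \<open>f\<close> itself contributes only when the outcomes disagree.
    This is the one traversal that \<open>b - 1\<close> in the assumption \<open>move\<close> leaves
    room for.\<close>
  have f: "?T f \<le> z f * y f * (?Z A * ?Z B1 + ?Z A1 * ?Z B)"
  proof -
    have N: "edge_sum V y z \<eta> E A f = y f * ?Z A1" "edge_sum V y z \<eta> E B f = y f * ?Z B1"
      by (simp_all add: edge_sum_def A1_def B1_def)
    have "?T f = \<bar>z f * y f * (?Z A1 * ?Z B - ?Z A * ?Z B1)\<bar>"
      unfolding N ZA ZB by (rule arg_cong[where f = abs]) (simp add: algebra_simps)
    also have "\<dots> = z f * y f * \<bar>?Z A1 * ?Z B - ?Z A * ?Z B1\<bar>"
      using nn(2,3) by (simp add: abs_mult)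
    also have "\<dots> \<le> z f * y f * (?Z A * ?Z B1 + ?Z A1 * ?Z B)"
    proof (rule mult_left_mono)
      have "0 \<le> ?Z A1 * ?Z B" "0 \<le> ?Z A * ?Z B1" using nn(1) by simp_all
      then show "\<bar>?Z A1 * ?Z B - ?Z A * ?Z B1\<bar> \<le> ?Z A * ?Z B1 + ?Z A1 * ?Z B" by linarith
    qed (use nn in simp)
    finally show ?thesis .
  qed
  have "discrepancy V y z \<eta> E A B = ?T f + (\<Sum>g\<in>?E. ?T g)"
    unfolding discrepancy_def using assms(3,4) by (rule sum.remove)
  also have "\<dots> \<le> z f * y f * (?Z A * ?Z B1 + ?Z A1 * ?Z B) +
      (\<Sum>g\<in>?E. z f * z f * t A B g + y f * y f * t A1 B1 g + z f * y f * (t A B1 g + t A1 B g))"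
    by (intro add_mono f sum_mono g)
  also have "\<dots> = z f * y f * (?Z A * ?Z B1 + ?Z A1 * ?Z B) +
      (z f * z f * ?D A B + y f * y f * ?D A1 B1 + z f * y f * (?D A B1 + ?D A1 B))"
    by (simp add: Dt sum.distrib flip: sum_distrib_left)
  also have "\<dots> \<le> z f * y f * (?Z A * ?Z B1 + ?Z A1 * ?Z B) +
      (z f * z f * (b * (?Z A * ?Z B)) + y f * y f * (b * (?Z A1 * ?Z B1)) +
       z f * y f * ((b - 1) * (?Z A * ?Z B1) + (b - 1) * (?Z A1 * ?Z B)))"
    using nn(2,3) stay[of A] stay[of A1] move[of A] move[of A1]
    unfolding B_def[symmetric] B1[symmetric] AB1[symmetric] BA1[symmetric]
    by (intro add_mono mult_left_mono order_refl) auto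
  also have "\<dots> = b * (parity_sum V y z \<eta> E A * parity_sum V y z \<eta> E B)"
    unfolding ZA ZB by (simp add: algebra_simps)
  finally show ?thesis .
qed

text \<open>A walker without unrevealed edges at its forced position is stuck: one of the two odd
  sets contains \<open>v\<close> and cannot be realised, so its partition function and all its edge
  sums vanish.\<close>

lemma discrepancy_isolated:
  assumes "finite V" "v \<in> V" "\<eta> v = 0" "\<And>e. e \<in> E \<Longrightarrow> v \<notin> e"
  shows "discrepancy V y z \<eta> E A (sym_diff A {v}) = 0"
proof -
  have zero: "discrepancy V y z \<eta> E C D = 0" if C: "v \<in> C" for C D
  proof -
    have "parity_sum V y z \<eta> E C = 0"
      by (rule parity_sum_eq_0[where v = v]) (use assms C in auto)
    moreover have "edge_sum V y z \<eta> E C g = 0" if "g \<in> E" for g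
    proof -
      have "v \<in> sym_diff C g" using C assms(4)[OF that] by simp
      then have "parity_sum V y z \<eta> (E - {g}) (sym_diff C g) = 0"
        using assms by (intro parity_sum_eq_0[where v = v]) auto
      then show ?thesis by (simp add: edge_sum_def)
    qed
    ultimately show ?thesis by (simp add: discrepancy_def)
  qed
  show ?thesis
  proof (cases "v \<in> A")
    case True
    then show ?thesis by (rule zero)
  next
    case False
    then have "v \<in> sym_diff A {v}" by simp
    then show ?thesis unfolding discrepancy_commute[of V y z \<eta> E A] by (rule zero)
  qed
qed

text \<open>
  \<open>H\<close> is the set of vertices visited by the discrepancy, whose parities are already forced.
  Every new vertex is left with probability at most \<open>l\<close>, so the size \<open>K\<close> of \<open>H\<close> has geometric tails,
  and no edge is traversed twice; this bounds the number of traversed edges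
  by roughly \<open>K\<^sup>2 / 2\<close>. The bound in terms of \<open>r\<close> solves the resulting recursion.
\<close>

lemma discrepancy_hard_vertex:
  fixes l :: real
  defines "r \<equiv> 1 / (1 - l)"
  assumes "finite E" "simple_graph V E" "0 \<le> l" "l < 1"
    and \<eta>: "\<And>v. v \<in> V \<Longrightarrow> 0 \<le> \<eta> v \<and> \<eta> v \<le> 1 \<and> 1 - \<eta> v \<le> l * (1 + \<eta> v)"
    and yz: "\<And>e. e \<in> E \<Longrightarrow> 0 \<le> y e \<and> 0 \<le> z e"
    and "H \<subseteq> V" "v \<in> H"
  shows "discrepancy V y z (harden H \<eta>) E A (sym_diff A {v}) \<le>
    (real (card {e\<in>E. e \<subseteq> H}) + (real (card H) - 1) * (r - 1) + r\<^sup>2) *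
    (parity_sum V y z (harden H \<eta>) E A * parity_sum V y z (harden H \<eta>) E (sym_diff A {v}))"
  using assms(2,3) yz \<open>H \<subseteq> V\<close> \<open>v \<in> H\<close>
proof (induction "card E" arbitrary: E H v A rule: less_induct)
  case less
  have finV: "finite V" using less.prems(2) by (simp add: simple_graph_def)
  have finH: "finite H" using finV less.prems(4) finite_subset by blast
  have hard: "0 \<le> harden H \<eta> w" if "w \<in> V" for w H
    using \<eta>[OF that] by (simp add: harden_def)
  have nn: "0 \<le> parity_sum V y z (harden H \<eta>) F A" if "F \<subseteq> E" for H F A
    using less.prems(3) that hard by (intro parity_sum_nonneg) auto
  have r: "1 \<le> r" using assms(4,5) by (simp add: r_def)
  have lr: "l * r = r - 1" using assms(5) by (simp add: r_def field_simps)
  \<comment> \<open>The first summand allows one traversal of each unrevealed edge inside the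
    visited set. The rest accounts for vertices yet to be discovered; \<open>r - 1\<close> is the
    geometric sum of \<open>l ^ k\<close> over positive \<open>k\<close>.\<close>
  define b where "b F K = real (card {e\<in>F. e \<subseteq> K}) + (real (card K) - 1) * (r - 1) + r\<^sup>2"
    for F :: "'a set set" and K
  have b0: "0 \<le> b F K" if "card K > 0" for F K
    using r that by (simp add: b_def)
  show ?case
  proof (cases "\<exists>f\<in>E. v \<in> f")
    case False
    then have "discrepancy V y z (harden H \<eta>) E A (sym_diff A {v}) = 0"
      using less.prems finV by (intro discrepancy_isolated) (auto simp: harden_def)
    moreover have "card H > 0" using finH less.prems(5) by (auto simp: card_gt_0_iff)
    ultimately show ?thesis
      using nn[of E] b0[of H E] by (simp add: b_def)
  next
    case True
    then obtain f where f: "f \<in> E" "v \<in> f" by blast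
    then have "card f = 2" "f \<subseteq> V" using less.prems(2) by (auto simp: simple_graph_def)
    then obtain u where u: "f = {v, u}" "u \<noteq> v" "u \<in> V"
      using f(2) by (auto simp: card_2_iff)
    let ?E = "E - {f}"
    have IH: "discrepancy V y z (harden K \<eta>) ?E A (sym_diff A {w}) \<le>
        b ?E K * (parity_sum V y z (harden K \<eta>) ?E A * parity_sum V y z (harden K \<eta>) ?E (sym_diff A {w}))"
      if "K \<subseteq> V" "w \<in> K" for K w A
      unfolding b_def
    proof (rule less.hyps)
      show "card ?E < card E" using f(1) less.prems(1) by (rule card_Diff1_less[rotated])
    qed (use that less.prems in \<open>auto simp: simple_graph_def\<close>)
    have cH: "card {e\<in>?E. e \<subseteq> H} \<le> card {e\<in>E. e \<subseteq> H}"
      using less.prems(1) by (intro card_mono) auto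
    have prod_nn: "0 \<le> parity_sum V y z (harden H \<eta>) ?E A * parity_sum V y z (harden H \<eta>) ?E B" for A B
      using nn[of ?E] by simp
    have "discrepancy V y z (harden H \<eta>) E A (sym_diff A {v}) \<le>
      b E H * (parity_sum V y z (harden H \<eta>) E A * parity_sum V y z (harden H \<eta>) E (sym_diff A {v}))"
    proof (rule discrepancy_edge_step[of E v u, folded u(1)])
      fix A
      have "discrepancy V y z (harden H \<eta>) ?E A (sym_diff A {v}) \<le>
        b ?E H * (parity_sum V y z (harden H \<eta>) ?E A * parity_sum V y z (harden H \<eta>) ?E (sym_diff A {v}))"
        using less.prems by (intro IH) auto
      also have "\<dots> \<le> b E H * (parity_sum V y z (harden H \<eta>) ?E A * parity_sum V y z (harden H \<eta>) ?E (sym_diff A {v}))"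
        using cH by (intro mult_right_mono prod_nn) (simp add: b_def)
      finally show "discrepancy V y z (harden H \<eta>) ?E A (sym_diff A {v}) \<le> \<dots>" .
    next
      fix A
      let ?ZZ = "parity_sum V y z (harden H \<eta>) ?E A * parity_sum V y z (harden H \<eta>) ?E (sym_diff A {u})"
      have "\<exists>c. discrepancy V y z (harden H \<eta>) ?E A (sym_diff A {u}) \<le> c * ?ZZ \<and> c \<le> b E H - 1"
      proof (cases "u \<in> H")
        case True
        \<comment> \<open>The walker returns to a visited vertex. The edge \<open>f\<close> inside
          \<open>H\<close> is used up, which pays for its traversal.\<close>
        have "{e\<in>E. e \<subseteq> H} = insert f {e\<in>?E. e \<subseteq> H}"
          using f u True less.prems(5) by auto
        then have "card {e\<in>E. e \<subseteq> H} = Suc (card {e\<in>?E. e \<subseteq> H})"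
          using less.prems(1) by simp
        then have "b ?E H \<le> b E H - 1" by (simp add: b_def)
        then show ?thesis using IH[of H u A] True less.prems(4) by blast
      next
        case False
        let ?K = "insert u H"
        have up: "(harden H \<eta>)(u := 0) = harden ?K \<eta>" by (auto simp: harden_def)
        have cK: "card ?K = Suc (card H)" using False finH by simp
        \<comment> \<open>The parity at \<open>u\<close> is still soft, so the first visit gains the
          factor \<open>l\<close>, and afterwards \<open>u\<close> belongs to the visited
          set.\<close>
        have "discrepancy V y z (harden H \<eta>) ?E A (sym_diff A {u}) \<le> l * b ?E ?K * ?ZZ"
          using \<eta>[OF u(3)] False IH[of ?K u] u(3) less.prems(4) nn[of ?E] finV b0[of ?K ?E] cK
          by (intro discrepancy_soft_vertex) (auto simp: up harden_def)
        moreover have "l * b ?E ?K \<le> b E H - 1"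
        proof -
          \<comment> \<open>The new edges inside the visited set join \<open>u\<close> to
            \<open>H\<close>. The image also contains the revealed edge \<open>f\<close>; the bound
            \<open>b\<close> leaves room for this overcount by one.\<close>
          have "{e\<in>?E. e \<subseteq> ?K} \<subseteq> {e\<in>?E. e \<subseteq> H} \<union> (\<lambda>w. {w, u}) ` H"
          proof
            fix e assume e: "e \<in> {e\<in>?E. e \<subseteq> ?K}"
            then have "card e = 2" using less.prems(2) by (auto simp: simple_graph_def)
            then obtain x w where "e = {x, w}" "x \<noteq> w" by (auto simp: card_2_iff)
            then show "e \<in> {e\<in>?E. e \<subseteq> H} \<union> (\<lambda>w. {w, u}) ` H"
              using e by (cases "x = u"; cases "w = u") (auto simp: insert_commute)
          qed
          then have "card {e\<in>?E. e \<subseteq> ?K} \<le> card ({e\<in>?E. e \<subseteq> H} \<union> (\<lambda>w. {w, u}) ` H)"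
            using less.prems(1) finH by (intro card_mono) auto
          also have "\<dots> \<le> card {e\<in>?E. e \<subseteq> H} + card ((\<lambda>w. {w, u}) ` H)"
            by (rule card_Un_le)
          also have "\<dots> \<le> card {e\<in>E. e \<subseteq> H} + card H"
            using cH card_image_le[OF finH] by (rule add_mono)
          finally have "b ?E ?K \<le> real (card {e\<in>E. e \<subseteq> H}) + card H + card H * (r - 1) + r\<^sup>2"
            unfolding b_def cK by simp
          then have "l * b ?E ?K \<le> l * (real (card {e\<in>E. e \<subseteq> H}) + card H + card H * (r - 1) + r\<^sup>2)"
            using assms(4) by (rule mult_left_mono)
          \<comment> \<open>The identity \<open>l * r = r - 1\<close> reproduces the shape of
            \<open>b\<close>; the only loss from here on is dropping \<open>l\<close> in front of
            the old edge count.\<close>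
          also have "\<dots> = l * card {e\<in>E. e \<subseteq> H} + (l * r) * (card H + r)"
            by (simp add: algebra_simps power2_eq_square)
          also have "\<dots> \<le> card {e\<in>E. e \<subseteq> H} + (r - 1) * (card H + r)"
            unfolding lr using assms(4,5) by (intro add_mono mult_left_le_one_le) auto
          also have "\<dots> = b E H - 1"
            by (simp add: b_def algebra_simps power2_eq_square)
          finally show ?thesis .
        qed
        ultimately show ?thesis by blast
      qed
      then obtain c where c: "discrepancy V y z (harden H \<eta>) ?E A (sym_diff A {u}) \<le> c * ?ZZ" "c \<le> b E H - 1"
        by blast
      then show "discrepancy V y z (harden H \<eta>) ?E A (sym_diff A {u}) \<le> (b E H - 1) * ?ZZ"
        using mult_right_mono[OF c(2) prod_nn] by (blast intro: order_trans)
    qed (use f u less.prems nn[of ?E] in auto)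
    then show ?thesis by (simp add: b_def)
  qed
qed

text \<open>The walk starts with \<open>v\<close> as its only visited vertex: no edge lies inside
  \<open>{v}\<close> and \<open>card {v} - 1 = 0\<close>, so the forced bound reduces to
  \<open>r\<^sup>2\<close>. The factor \<open>l\<close> gained by forcing \<open>v\<close> is then
  estimated by 1.\<close>

lemma discrepancy_vertex:
  fixes l :: real
  assumes "simple_graph V E" "0 \<le> l" "l < 1"
    and \<eta>: "\<And>v. v \<in> V \<Longrightarrow> 0 \<le> \<eta> v \<and> \<eta> v \<le> 1 \<and> 1 - \<eta> v \<le> l * (1 + \<eta> v)"
    and yz: "\<And>e. e \<in> E \<Longrightarrow> 0 \<le> y e \<and> 0 \<le> z e"
    and "v \<in> V"
  shows "discrepancy V y z \<eta> E A (sym_diff A {v}) \<le>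
    (1 / (1 - l))\<^sup>2 * (parity_sum V y z \<eta> E A * parity_sum V y z \<eta> E (sym_diff A {v}))"
proof -
  have fin: "finite E" "finite V"
    using assms(1) simple_graph_finite_edges by (auto simp: simple_graph_def)
  have up: "\<eta>(v := 0) = harden {v} \<eta>" by (auto simp: harden_def)
  have no_edge: "{e\<in>E. e \<subseteq> {v}} = {}"
  proof -
    have "card e \<noteq> 2" if "e \<subseteq> {v}" for e using card_mono[OF _ that] by simp
    then show ?thesis using assms(1) unfolding simple_graph_def by blast
  qed
  have nn: "0 \<le> parity_sum V y z \<eta>' E A" if "\<And>w. w \<in> V \<Longrightarrow> 0 \<le> \<eta>' w" for \<eta>' A
    using yz that by (intro parity_sum_nonneg) auto
  have "discrepancy V y z \<eta> E A (sym_diff A {v}) \<le>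
    l * (1 / (1 - l))\<^sup>2 * (parity_sum V y z \<eta> E A * parity_sum V y z \<eta> E (sym_diff A {v}))"
  proof (rule discrepancy_soft_vertex)
    show "discrepancy V y z (\<eta>(v := 0)) E A (sym_diff A {v}) \<le> (1 / (1 - l))\<^sup>2 *
      (parity_sum V y z (\<eta>(v := 0)) E A * parity_sum V y z (\<eta>(v := 0)) E (sym_diff A {v}))"
      unfolding up
      using discrepancy_hard_vertex[where V = V and E = E and l = l and \<eta> = \<eta> and y = y and z = z
          and H = "{v}" and v = v and A = A] fin(1) assms no_edge
      by simp
  qed (use fin assms nn in auto)
  also have "\<dots> \<le> (1 / (1 - l))\<^sup>2 * (parity_sum V y z \<eta> E A * parity_sum V y z \<eta> E (sym_diff A {v}))"
    using assms(2,3) nn \<eta> by (intro mult_right_mono mult_left_le_one_le) auto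
  finally show ?thesis .
qed

text \<open>The shift by \<open>f = {u, v}\<close> is made in two single-vertex shifts, passing
  through the odd set \<open>{u}\<close>; each contributes one half of the bound.\<close>

lemma discrepancy_edge:
  fixes l :: real
  assumes "simple_graph V E" "0 \<le> l" "l < 1"
    and \<eta>: "\<And>v. v \<in> V \<Longrightarrow> 0 < \<eta> v \<and> \<eta> v \<le> 1 \<and> 1 - \<eta> v \<le> l * (1 + \<eta> v)"
    and yz: "\<And>e. e \<in> E \<Longrightarrow> 0 \<le> y e \<and> 0 < z e"
    and "f \<subseteq> V" "card f = 2"
  shows "discrepancy V y z \<eta> E {} f \<le>
    2 * (1 / (1 - l))\<^sup>2 * (parity_sum V y z \<eta> E {} * parity_sum V y z \<eta> E f)"
proof -
  obtain u v where f: "f = {u, v}" "u \<noteq> v" using assms(7) by (auto simp: card_2_iff)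
  let ?Z = "parity_sum V y z \<eta> E" and ?N = "edge_sum V y z \<eta> E" and ?c = "(1 / (1 - l))\<^sup>2"
  have fin: "finite E" using assms(1) by (rule simple_graph_finite_edges)
  have pos: "0 < ?Z A" for A using fin yz \<eta> by (intro parity_sum_pos) auto
  have sd: "sym_diff {u} {v} = f" "sym_diff {} {u} = {u}" using f by auto
  have uv: "u \<in> V" "v \<in> V" using assms(6) f(1) by auto
  have \<eta>':  "0 \<le> \<eta> v \<and> \<eta> v \<le> 1 \<and> 1 - \<eta> v \<le> l * (1 + \<eta> v)" if "v \<in> V" for v
    using \<eta>[OF that] by simp
  have yz': "0 \<le> y e \<and> 0 \<le> z e" if "e \<in> E" for e
    using yz[OF that] by simp
  have D: "discrepancy V y z \<eta> E {} {u} \<le> ?c * (?Z {} * ?Z {u})"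
      "discrepancy V y z \<eta> E {u} f \<le> ?c * (?Z {u} * ?Z f)"
    using discrepancy_vertex[where A = "{}" and \<eta> = \<eta> and y = y and z = z, OF assms(1-3) \<eta>' yz' uv(1)]
      discrepancy_vertex[where A = "{u}" and \<eta> = \<eta> and y = y and z = z, OF assms(1-3) \<eta>' yz' uv(2)]
    unfolding sd by blast+
  \<comment> \<open>This is the triangle inequality for the edge marginals, cleared of
    denominators.\<close>
  have "?Z {u} * discrepancy V y z \<eta> E {} f \<le>
      ?Z f * discrepancy V y z \<eta> E {} {u} + ?Z {} * discrepancy V y z \<eta> E {u} f"
    unfolding discrepancy_def sum_distrib_left sum.distrib[symmetric]
  proof (rule sum_mono)
    fix g
    have "?Z {u} * \<bar>?N {} g * ?Z f - ?N f g * ?Z {}\<bar> = \<bar>?Z {u} * (?N {} g * ?Z f - ?N f g * ?Z {})\<bar>"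
      using pos[of "{u}"] by (simp add: abs_mult)
    also have "\<dots> = \<bar>?Z f * (?N {} g * ?Z {u} - ?N {u} g * ?Z {}) + ?Z {} * (?N {u} g * ?Z f - ?N f g * ?Z {u})\<bar>"
      by (rule arg_cong[where f = abs]) (simp add: algebra_simps)
    also have "\<dots> \<le> \<bar>?Z f * (?N {} g * ?Z {u} - ?N {u} g * ?Z {})\<bar> + \<bar>?Z {} * (?N {u} g * ?Z f - ?N f g * ?Z {u})\<bar>"
      by (rule abs_triangle_ineq)
    finally show "?Z {u} * \<bar>?N {} g * ?Z f - ?N f g * ?Z {}\<bar> \<le>
        ?Z f * \<bar>?N {} g * ?Z {u} - ?N {u} g * ?Z {}\<bar> + ?Z {} * \<bar>?N {u} g * ?Z f - ?N f g * ?Z {u}\<bar>"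
      using pos[of f] pos[of "{}"] by (simp add: abs_mult)
  qed
  also have "\<dots> \<le> ?Z f * (?c * (?Z {} * ?Z {u})) + ?Z {} * (?c * (?Z {u} * ?Z f))"
    using D pos by (intro add_mono mult_left_mono) (auto intro: less_imp_le)
  also have "\<dots> = ?Z {u} * (2 * ?c * (?Z {} * ?Z f))"
    by (simp add: algebra_simps)
  finally show ?thesis
    using pos[of "{u}"] by simp
qed

section \<open>Components, spins and the high-temperature expansion\<close>

lemma equiv_connected_by: "equiv V (connected_by V S)"
proof (rule equivI)
  let ?R = "{(x, y). {x, y} \<in> S}"
  have "sym (?R\<^sup>*)"
    by (rule sym_rtrancl) (auto simp: sym_def insert_commute)
  then show "sym (connected_by V S)"
    by (auto simp: connected_by_def sym_def)
  show "trans (connected_by V S)"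
    by (auto simp: connected_by_def trans_def intro: rtrancl_trans)
qed (auto simp: connected_by_def refl_on_def)

text \<open>\<open>U\<close> collects the components that contribute their factor \<open>\<Prod>j\<in>C. lam j\<close>.\<close>

lemma prod_components:
  fixes lam :: "'v \<Rightarrow> real"
  assumes "finite V" and S: "\<And>e. e \<in> S \<Longrightarrow> e \<subseteq> V \<and> card e = 2"
  shows "(\<Prod>C\<in>components_of_graph V S. 1 + (\<Prod>j\<in>C. lam j)) =
    (\<Sum>U\<in>Pow V. if \<forall>e\<in>S. e \<subseteq> U \<or> e \<inter> U = {} then \<Prod>j\<in>U. lam j else 0)"
proof -
  let ?K = "components_of_graph V S" and ?R = "connected_by V S"
  let ?cl = "{U\<in>Pow V. \<forall>e\<in>S. e \<subseteq> U \<or> e \<inter> U = {}}"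
  have eq: "equiv V ?R" by (rule equiv_connected_by)
  have finK: "finite ?K"
    unfolding components_of_graph_def using assms(1)
    by (rule finite_quotient) (auto simp: connected_by_def)
  have fin: "finite C" if "C \<in> ?K" for C
    using component_subset[OF that] assms(1) finite_subset by blast
  have disj: "C = D" if "C \<in> ?K" "D \<in> ?K" "x \<in> C" "x \<in> D" for C D x
    using quotient_disj[OF eq] that unfolding components_of_graph_def by blast
  have ne: "C \<noteq> {}" if "C \<in> ?K" for C
    using in_quotient_imp_non_empty[OF eq] that unfolding components_of_graph_def by blast
  have inj: "inj_on Union (Pow ?K)"
  proof (rule inj_onI)
    have "C \<in> T'" if T: "T \<subseteq> ?K" "T' \<subseteq> ?K" "\<Union>T = \<Union>T'" "C \<in> T" for T T' C
    proof -
      obtain x where x: "x \<in> C" using ne T by blast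
      then obtain D where "D \<in> T'" "x \<in> D" using T by blast
      then show ?thesis using disj[of C D x] x T by blast
    qed
    then show "T = T'" if "T \<in> Pow ?K" "T' \<in> Pow ?K" "\<Union>T = \<Union>T'" for T T'
      using that by (metis PowD subsetI subset_antisym)
  qed
  \<comment> \<open>Unions of components are exactly the vertex sets that no edge of
    \<open>S\<close> leaves, so expanding the product over components sums over those sets.\<close>
  have img: "Union ` Pow ?K = ?cl"
  proof (rule set_eqI, rule iffI)
    fix U assume "U \<in> Union ` Pow ?K"
    then obtain T where T: "T \<subseteq> ?K" "U = \<Union>T" by blast
    have "e \<subseteq> U" if e: "e \<in> S" "x \<in> e" "x \<in> U" for e x
    proof
      fix w assume w: "w \<in> e"
      obtain C where C: "C \<in> T" "x \<in> C" using T e by blast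
      show "w \<in> U"
      proof (cases "w = x")
        case False
        have "e = {x, w}"
          using S[OF e(1)] e(2) w False by (auto simp: card_2_iff)
        then have "(x, w) \<in> ?R"
          using e(1) S[OF e(1)] by (auto simp: connected_by_def)
        then have "w \<in> C"
          using in_quotient_imp_closed[OF eq, of C x w] C T(1) by (auto simp: components_of_graph_def)
        then show ?thesis using C T by blast
      qed (use e in simp)
    qed
    moreover have "U \<subseteq> V" using T component_subset by fastforce
    ultimately show "U \<in> ?cl" by blast
  next
    fix U assume U: "U \<in> ?cl"
    have "?R `` {v} \<subseteq> U" if "v \<in> U" for v
    proof
      fix w assume "w \<in> ?R `` {v}"
      then have "(v, w) \<in> {(x, y). {x, y} \<in> S}\<^sup>*" by (simp add: connected_by_def)
      then show "w \<in> U"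
        by (induction rule: rtrancl_induct) (use that U in auto)
    qed
    moreover have "v \<in> ?R `` {v}" if "v \<in> U" for v
      using that U eq by (auto simp: connected_by_def)
    ultimately have "U = \<Union>((\<lambda>v. ?R `` {v}) ` U)" by blast
    moreover have "(\<lambda>v. ?R `` {v}) ` U \<in> Pow ?K"
      using U by (auto simp: components_of_graph_def intro: quotientI)
    ultimately show "U \<in> Union ` Pow ?K" by blast
  qed
  have "(\<Prod>C\<in>?K. 1 + (\<Prod>j\<in>C. lam j)) = (\<Prod>C\<in>?K. (\<Prod>j\<in>C. lam j) + 1)"
    by (simp add: add.commute)
  also have "\<dots> = (\<Sum>T\<in>Pow ?K. (\<Prod>C\<in>T. \<Prod>j\<in>C. lam j))"
    by (subst prod_add[OF finK]) simp
  also have "\<dots> = (\<Sum>T\<in>Pow ?K. \<Prod>j\<in>\<Union>T. lam j)"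
  proof (rule sum.cong[OF refl])
    fix T assume T: "T \<in> Pow ?K"
    show "(\<Prod>C\<in>T. \<Prod>j\<in>C. lam j) = (\<Prod>j\<in>\<Union>T. lam j)"
      using T fin disj by (subst prod.Union_disjoint) fastforce+
  qed
  also have "\<dots> = (\<Sum>U\<in>?cl. \<Prod>j\<in>U. lam j)"
    unfolding img[symmetric] by (simp add: sum.reindex[OF inj])
  also have "\<dots> = (\<Sum>U\<in>Pow V. if \<forall>e\<in>S. e \<subseteq> U \<or> e \<inter> U = {} then \<Prod>j\<in>U. lam j else 0)"
    using assms(1) by (intro sum.inter_filter) simp
  finally show ?thesis .
qed

text \<open>
  The high-temperature expansion of the Ising model behind the random cluster model, with
  spins \<open>-1\<close> on \<open>U\<close> and \<open>1\<close> off \<open>U\<close>.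
\<close>

lemma sum_components_eq_parity_sum:
  fixes lam :: "'v \<Rightarrow> real"
  assumes G: "simple_graph V E" and lam: "\<And>v. v \<in> V \<Longrightarrow> 1 + lam v \<noteq> 0"
  shows "(\<Sum>S\<in>Pow E. (\<Prod>e\<in>S. \<alpha> e) * (\<Prod>e\<in>E - S. \<beta> e) *
      (\<Prod>C\<in>components_of_graph V S. 1 + (\<Prod>j\<in>C. lam j))) =
    (\<Prod>v\<in>V. 1 + lam v) *
    parity_sum V (\<lambda>e. \<alpha> e / 2) (\<lambda>e. \<beta> e + \<alpha> e / 2) (\<lambda>v. (1 - lam v) / (1 + lam v)) E {}"
proof -
  have fin: "finite V" "finite E"
    using G simple_graph_finite_edges by (auto simp: simple_graph_def)
  have E: "e \<subseteq> V" "card e = 2" if "e \<in> E" for e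
    using G that by (auto simp: simple_graph_def)
  define m where "m U e \<longleftrightarrow> e \<subseteq> U \<or> e \<inter> U = {}" for U e :: "'v set"
  define s where "s U v = (if v \<in> U then - 1 else 1 :: real)" for U and v :: 'v
  define n where "n S v = card {e\<in>S. v \<in> e}" for S and v :: 'v
  \<comment> \<open>\<open>e\<close> is monochromatic exactly when the product of its two spins is
    1, so the indicator is half of 1 plus that product.\<close>
  have edge: "(if m U e then \<alpha> e else 0) + \<beta> e = \<alpha> e / 2 * (\<Prod>v\<in>e. s U v) + (\<beta> e + \<alpha> e / 2)"
    if e: "e \<in> E" for U e
  proof -
    obtain u v where "e = {u, v}" "u \<noteq> v" using E(2)[OF e] by (auto simp: card_2_iff)
    then show ?thesis by (auto simp: m_def s_def)
  qed
  have swap: "(\<Prod>e\<in>S. \<Prod>v\<in>e. s U v) = (\<Prod>v\<in>V. s U v ^ n S v)" if "S \<subseteq> E" for S U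
  proof -
    have finS: "finite S" using that fin finite_subset by blast
    have "(\<Prod>e\<in>S. \<Prod>v\<in>e. s U v) = (\<Prod>e\<in>S. \<Prod>v\<in>V. if v \<in> e then s U v else 1)"
    proof (rule prod.cong[OF refl])
      fix e assume "e \<in> S"
      then have "V \<inter> e = e" using E that by blast
      then show "(\<Prod>v\<in>e. s U v) = (\<Prod>v\<in>V. if v \<in> e then s U v else 1)"
        using prod.inter_restrict[OF fin(1), of "s U" e] by simp
    qed
    also have "\<dots> = (\<Prod>v\<in>V. \<Prod>e\<in>S. if v \<in> e then s U v else 1)"
      by (rule prod.swap)
    also have "\<dots> = (\<Prod>v\<in>V. s U v ^ n S v)"
      using finS by (simp add: prod.inter_filter[symmetric] n_def)
    finally show ?thesis .
  qed
  \<comment> \<open>The spin sum factorises over vertices: an even exponent gives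
    \<open>1 + lam v\<close>, an odd one \<open>1 - lam v\<close>.\<close>
  have vertices: "(\<Sum>U\<in>Pow V. (\<Prod>j\<in>U. lam j) * (\<Prod>v\<in>V. s U v ^ k v)) =
      (\<Prod>v\<in>V. 1 + lam v) * (\<Prod>v\<in>V. if odd (k v) then (1 - lam v) / (1 + lam v) else 1)" for k
  proof -
    have "(\<Sum>U\<in>Pow V. (\<Prod>j\<in>U. lam j) * (\<Prod>v\<in>V. s U v ^ k v)) =
        (\<Sum>U\<in>Pow V. (\<Prod>j\<in>U. lam j * (- 1) ^ k j) * (\<Prod>j\<in>V - U. 1))"
    proof (rule sum.cong[OF refl])
      fix U assume U: "U \<in> Pow V"
      have "(\<Prod>v\<in>V. s U v ^ k v) = (\<Prod>v\<in>V - U. s U v ^ k v) * (\<Prod>v\<in>U. s U v ^ k v)"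
        using U fin by (intro prod.subset_diff) auto
      also have "\<dots> = (\<Prod>v\<in>U. (- 1) ^ k v)" by (simp add: s_def)
      finally show "(\<Prod>j\<in>U. lam j) * (\<Prod>v\<in>V. s U v ^ k v) =
          (\<Prod>j\<in>U. lam j * (- 1) ^ k j) * (\<Prod>j\<in>V - U. 1)"
        by (simp add: prod.distrib)
    qed
    also have "\<dots> = (\<Prod>v\<in>V. lam v * (- 1) ^ k v + 1)"
      by (rule prod_add[OF fin(1), symmetric])
    also have "\<dots> = (\<Prod>v\<in>V. (1 + lam v) * (if odd (k v) then (1 - lam v) / (1 + lam v) else 1))"
      using lam by (intro prod.cong) auto
    finally show ?thesis by (simp add: prod.distrib)
  qed
  have "(\<Sum>S\<in>Pow E. (\<Prod>e\<in>S. \<alpha> e) * (\<Prod>e\<in>E - S. \<beta> e) *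
      (\<Prod>C\<in>components_of_graph V S. 1 + (\<Prod>j\<in>C. lam j))) =
      (\<Sum>S\<in>Pow E. \<Sum>U\<in>Pow V. (\<Prod>j\<in>U. lam j) *
        ((\<Prod>e\<in>S. if m U e then \<alpha> e else 0) * (\<Prod>e\<in>E - S. \<beta> e)))"
  proof (rule sum.cong[OF refl])
    fix S assume S: "S \<in> Pow E"
    have finS: "finite S" using S fin finite_subset by blast
    have comps: "(\<Prod>C\<in>components_of_graph V S. 1 + (\<Prod>j\<in>C. lam j)) =
        (\<Sum>U\<in>Pow V. if \<forall>e\<in>S. m U e then \<Prod>j\<in>U. lam j else 0)"
      unfolding m_def using S E fin by (intro prod_components) auto
    have mono: "(\<Prod>e\<in>S. if m U e then \<alpha> e else 0) = (if \<forall>e\<in>S. m U e then \<Prod>e\<in>S. \<alpha> e else 0)" for U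
      using finS by (auto intro!: prod.cong)
    show "(\<Prod>e\<in>S. \<alpha> e) * (\<Prod>e\<in>E - S. \<beta> e) *
        (\<Prod>C\<in>components_of_graph V S. 1 + (\<Prod>j\<in>C. lam j)) =
        (\<Sum>U\<in>Pow V. (\<Prod>j\<in>U. lam j) *
          ((\<Prod>e\<in>S. if m U e then \<alpha> e else 0) * (\<Prod>e\<in>E - S. \<beta> e)))"
      unfolding comps mono sum_distrib_left by (intro sum.cong) auto
  qed
  also have "\<dots> = (\<Sum>U\<in>Pow V. \<Sum>S\<in>Pow E. (\<Prod>j\<in>U. lam j) *
        ((\<Prod>e\<in>S. if m U e then \<alpha> e else 0) * (\<Prod>e\<in>E - S. \<beta> e)))"
    by (rule sum.swap)
  \<comment> \<open>For fixed spins the random cluster edges are independent and sum out to a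
    product over \<open>E\<close>.\<close>
  also have "\<dots> = (\<Sum>U\<in>Pow V. (\<Prod>j\<in>U. lam j) * (\<Prod>e\<in>E. (if m U e then \<alpha> e else 0) + \<beta> e))"
    by (simp add: prod_add[OF fin(2)] sum_distrib_left)
  also have "\<dots> = (\<Sum>U\<in>Pow V. (\<Prod>j\<in>U. lam j) *
        (\<Prod>e\<in>E. \<alpha> e / 2 * (\<Prod>v\<in>e. s U v) + (\<beta> e + \<alpha> e / 2)))"
    by (simp only: edge cong: prod.cong)
  \<comment> \<open>From here on \<open>S\<close> is no longer the random cluster configuration: it
    is the set of edges from which the spin product is taken.\<close>
  also have "\<dots> = (\<Sum>U\<in>Pow V. \<Sum>S\<in>Pow E. (\<Prod>j\<in>U. lam j) *
        ((\<Prod>e\<in>S. \<alpha> e / 2 * (\<Prod>v\<in>e. s U v)) * (\<Prod>e\<in>E - S. \<beta> e + \<alpha> e / 2)))"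
    by (simp add: prod_add[OF fin(2)] sum_distrib_left)
  also have "\<dots> = (\<Sum>S\<in>Pow E. \<Sum>U\<in>Pow V. (\<Prod>j\<in>U. lam j) *
        ((\<Prod>e\<in>S. \<alpha> e / 2 * (\<Prod>v\<in>e. s U v)) * (\<Prod>e\<in>E - S. \<beta> e + \<alpha> e / 2)))"
    by (rule sum.swap)
  also have "\<dots> = (\<Sum>S\<in>Pow E. (\<Prod>e\<in>S. \<alpha> e / 2) * (\<Prod>e\<in>E - S. \<beta> e + \<alpha> e / 2) *
        (\<Sum>U\<in>Pow V. (\<Prod>j\<in>U. lam j) * (\<Prod>v\<in>V. s U v ^ n S v)))"
    unfolding sum_distrib_left
  proof (intro sum.cong refl)
    fix S U assume "S \<in> Pow E"
    then have "(\<Prod>e\<in>S. \<Prod>v\<in>e. s U v) = (\<Prod>v\<in>V. s U v ^ n S v)" by (intro swap) simp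
    then show "(\<Prod>j\<in>U. lam j) *
        ((\<Prod>e\<in>S. \<alpha> e / 2 * (\<Prod>v\<in>e. s U v)) * (\<Prod>e\<in>E - S. \<beta> e + \<alpha> e / 2)) =
        (\<Prod>e\<in>S. \<alpha> e / 2) * (\<Prod>e\<in>E - S. \<beta> e + \<alpha> e / 2) *
        ((\<Prod>j\<in>U. lam j) * (\<Prod>v\<in>V. s U v ^ n S v))"
      by (simp only: prod.distrib) simp
  qed
  also have "\<dots> = (\<Prod>v\<in>V. 1 + lam v) *
    parity_sum V (\<lambda>e. \<alpha> e / 2) (\<lambda>e. \<beta> e + \<alpha> e / 2) (\<lambda>v. (1 - lam v) / (1 + lam v)) E {}"
    unfolding vertices parity_sum_def sum_distrib_left n_def by (simp add: mult_ac)
  finally show ?thesis .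
qed

section \<open>Event probabilities and the influence matrix\<close>

text \<open>The event is imposed through the edge weights: the weight of absence is set to 0 on
  \<open>I\<close> and that of presence on \<open>J\<close>. The expansion holds for arbitrary such
  weights.\<close>

lemma rc_weight_event_sum:
  fixes lam :: "'v \<Rightarrow> real"
  assumes G: "simple_graph V E" and lam: "\<forall>v\<in>V. lam v \<in> {0..<1}" and "I \<subseteq> E"
  shows "(\<Sum>S\<in>Pow E. if I \<subseteq> S \<and> S \<inter> J = {} then rc_weight V E p lam S else 0) =
    (\<Prod>v\<in>V. 1 + lam v) *
    parity_sum V (\<lambda>e. if e \<in> J then 0 else p e / 2)
      (\<lambda>e. (if e \<in> I then 0 else 1 - p e) + (if e \<in> J then 0 else p e / 2))
      (\<lambda>v. (1 - lam v) / (1 + lam v)) E {}"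
proof -
  let ?\<alpha> = "\<lambda>e. if e \<in> J then 0 else p e" and ?\<beta> = "\<lambda>e. if e \<in> I then 0 else 1 - p e"
  have half: "(if e \<in> J then 0 else p e / 2) = ?\<alpha> e / 2" for e by simp
  have lam': "1 + lam v \<noteq> 0" if "v \<in> V" for v using lam that by fastforce
  have fin: "finite E" using G by (rule simple_graph_finite_edges)
  have "(\<Sum>S\<in>Pow E. if I \<subseteq> S \<and> S \<inter> J = {} then rc_weight V E p lam S else 0) =
    (\<Sum>S\<in>Pow E. (\<Prod>e\<in>S. ?\<alpha> e) * (\<Prod>e\<in>E - S. ?\<beta> e) *
      (\<Prod>C\<in>components_of_graph V S. 1 + (\<Prod>j\<in>C. lam j)))"
  proof (rule sum.cong[OF refl])
    fix S assume "S \<in> Pow E"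
    then have finS: "finite S" "finite (E - S)" and SE: "S \<subseteq> E" using fin finite_subset by auto
    have "(\<Prod>e\<in>S. ?\<alpha> e) = (if S \<inter> J = {} then \<Prod>e\<in>S. p e else 0)"
      using finS(1) by (auto intro!: prod.cong)
    moreover have "(\<Prod>e\<in>E - S. ?\<beta> e) = (if I \<subseteq> S then \<Prod>e\<in>E - S. 1 - p e else 0)"
      using finS(2) assms(3) by (auto intro!: prod.cong)
    ultimately show "(if I \<subseteq> S \<and> S \<inter> J = {} then rc_weight V E p lam S else 0) =
        (\<Prod>e\<in>S. ?\<alpha> e) * (\<Prod>e\<in>E - S. ?\<beta> e) *
        (\<Prod>C\<in>components_of_graph V S. 1 + (\<Prod>j\<in>C. lam j))"
      by (simp add: rc_weight_def)
  qed
  also have "\<dots> = (\<Prod>v\<in>V. 1 + lam v) *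
    parity_sum V (\<lambda>e. ?\<alpha> e / 2) (\<lambda>e. ?\<beta> e + ?\<alpha> e / 2) (\<lambda>v. (1 - lam v) / (1 + lam v)) E {}"
    by (rule sum_components_eq_parity_sum[OF G lam'])
  finally show ?thesis by (simp only: half)
qed

lemma prob_random_cluster:
  assumes "simple_graph V E" "\<forall>e\<in>E. p e \<in> {0..1}" "\<forall>v\<in>V. lam v \<in> {0..<1}"
  shows "\<P>(S in random_cluster V E p lam. P S) =
    (\<Sum>S\<in>Pow E. if P S then rc_weight V E p lam S else 0) / rc_partition V E p lam"
proof -
  let ?\<mu> = "random_cluster V E p lam"
  have fin: "finite (Pow E)" using simple_graph_finite_edges[OF assms(1)] by simp
  have "\<P>(S in ?\<mu>. P S) = measure ?\<mu> ({S. P S} \<inter> Pow E)"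
    using set_pmf_random_cluster[OF assms]
    by (intro measure_pmf.finite_measure_eq_AE) (auto simp: AE_measure_pmf_iff)
  also have "\<dots> = (\<Sum>S\<in>{S. P S} \<inter> Pow E. pmf ?\<mu> S)"
    using fin by (intro measure_measure_pmf_finite) simp
  also have "\<dots> = (\<Sum>S\<in>Pow E. if P S then pmf ?\<mu> S else 0)"
    using sum.inter_restrict[OF fin, of "pmf ?\<mu>" "{S. P S}"] by (simp add: Int_commute)
  also have "\<dots> = (\<Sum>S\<in>Pow E. (if P S then rc_weight V E p lam S else 0) / rc_partition V E p lam)"
    by (rule sum.cong) (auto simp: pmf_random_cluster[OF assms])
  finally show ?thesis by (simp add: sum_divide_distrib)
qed

text \<open>
  Conditioning on \<open>e \<in> S\<close> contracts \<open>e\<close>, which in the expansion means mixing the configurations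
  with odd sets \<open>{}\<close> and \<open>e\<close> on \<open>E - {e}\<close>; conditioning on \<open>e \<notin> S\<close> leaves only the odd set \<open>{}\<close>.
\<close>

lemma influence_le_discrepancy:
  fixes V E p lam
  defines "\<eta> \<equiv> \<lambda>v. (1 - lam v) / (1 + lam v)"
    and "y \<equiv> \<lambda>e. p e / 2" and "z \<equiv> \<lambda>e. 1 - p e / 2"
  assumes G: "simple_graph V E" "\<forall>e\<in>E. p e \<in> {0..1}" "\<forall>v\<in>V. lam v \<in> {0..<1}"
    and "e \<in> E" "f \<in> E" "e \<noteq> f"
  defines "Z \<equiv> parity_sum V y z \<eta> (E - {e})" and "N \<equiv> edge_sum V y z \<eta> (E - {e})"
  assumes pos: "0 < Z {}" "0 < Z e"
  shows "\<bar>influence_matrix (random_cluster V E p lam) e f\<bar> \<le>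
    \<bar>N {} f * Z e - N e f * Z {}\<bar> / (Z {} * (Z {} + Z e))"
proof (cases "0 < \<P>(S in random_cluster V E p lam. e \<in> S) \<and> \<P>(S in random_cluster V E p lam. e \<in> S) < 1")
  case False
  then have "influence_matrix (random_cluster V E p lam) e f = 0"
    unfolding influence_matrix_def by auto
  then show ?thesis using pos by simp
next
  case True
  let ?\<mu> = "random_cluster V E p lam"
  have fin: "finite E" using G(1) by (rule simple_graph_finite_edges)
  define c where "c = (\<Prod>v\<in>V. 1 + lam v) / rc_partition V E p lam"
  define g where "g = parity_sum V y z \<eta> (E - {e} - {f})"
  define a where "a = p f / 2"
  \<comment> \<open>Requiring \<open>f\<close> in the random cluster set gives both parities of
    \<open>f\<close> in the expansion the same weight \<open>a\<close>; \<open>M\<close> is the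
    resulting counterpart of \<open>Z\<close>.\<close>
  define M where "M A = a * (g A + g (sym_diff A f))" for A
  have pf: "0 \<le> a" "a \<le> 1 / 2" using G(2) assms(8) by (auto simp: a_def)
  let ?Y = "\<lambda>J e. if e \<in> J then 0 else p e / 2"
  let ?W = "\<lambda>I J e. (if e \<in> I then 0 else 1 - p e) + (if e \<in> J then 0 else p e / 2)"
  have ev: "\<P>(S in ?\<mu>. I \<subseteq> S \<and> S \<inter> J = {}) = c * parity_sum V (?Y J) (?W I J) \<eta> E {}"
    if "I \<subseteq> E" for I J
    unfolding prob_random_cluster[OF G] rc_weight_event_sum[OF G(1,3) that] c_def \<eta>_def by simp
  have Z1: "parity_sum V (?Y J) (?W I J) \<eta> (E - {e}) A = Z A" if "I \<subseteq> {e}" "J \<subseteq> {e}" for I J A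
    unfolding Z_def y_def z_def using that by (intro parity_sum_cong) (auto simp: field_simps)
  have Z2: "parity_sum V (?Y J) (?W I J) \<eta> (E - {e}) A = M A" if "I \<subseteq> {e, f}" "J \<subseteq> {e}" "f \<in> I" for I J A
  proof -
    have eq_g: "parity_sum V (?Y J) (?W I J) \<eta> (E - {e} - {f}) A = g A" for A
      unfolding g_def y_def z_def using that by (intro parity_sum_cong) (auto simp: field_simps)
    have eq_a: "?Y J f = a" "?W I J f = a" using that assms(9) by (auto simp: a_def)
    have "finite (E - {e})" "f \<in> E - {e}" using fin assms by auto
    from parity_sum_edge[OF this, of V "?Y J" "?W I J" \<eta> A] show ?thesis
      unfolding eq_g eq_a using \<open>f \<in> I\<close> by (simp add: M_def distrib_left)
  qed
  note split_e = parity_sum_edge[OF fin assms(7)]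
  have inn: "\<P>(S in ?\<mu>. e \<in> S) = c * (p e / 2) * (Z {} + Z e)"
    using ev[of "{e}" "{}"] assms(7) Z1[of "{e}" "{}"] split_e[of V "?Y {}" "?W {e} {}" \<eta> "{}"]
    by (simp add: distrib_left)
  have out: "\<P>(S in ?\<mu>. e \<notin> S) = c * (1 - p e) * Z {}"
    using ev[of "{}" "{e}"] Z1[of "{}" "{e}"] split_e[of V "?Y {e}" "?W {} {e}" \<eta> "{}"]
    by simp
  have inn2: "\<P>(S in ?\<mu>. f \<in> S \<and> e \<in> S) = c * (p e / 2) * (M {} + M e)"
    using ev[of "{f, e}" "{}"] assms(7,8) Z2[of "{f, e}" "{}"] split_e[of V "?Y {}" "?W {f, e} {}" \<eta> "{}"]
    by (simp add: distrib_left)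
  have out2: "\<P>(S in ?\<mu>. f \<in> S \<and> e \<notin> S) = c * (1 - p e) * M {}"
    using ev[of "{f}" "{e}"] assms(8,9) Z2[of "{f}" "{e}"] split_e[of V "?Y {e}" "?W {f} {e}" \<eta> "{}"]
    by simp
  have "\<P>(S in ?\<mu>. e \<notin> S) = 1 - \<P>(S in ?\<mu>. e \<in> S)"
    using measure_pmf.prob_neg[where P = "\<lambda>S. e \<in> S" and M = ?\<mu>] by simp
  then have nz: "c * (p e / 2) \<noteq> 0" "c * (1 - p e) \<noteq> 0"
    using True inn out by auto
  have "influence_matrix ?\<mu> e f = (M {} + M e) / (Z {} + Z e) - M {} / Z {}"
    using True assms(9) nz pos unfolding influence_matrix_def cond_prob_def inn inn2 out out2 by simp
  also have "\<dots> = (M e * Z {} - M {} * Z e) / (Z {} * (Z {} + Z e))"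
    using pos by (simp add: field_simps)
  finally have infl: "\<bar>influence_matrix ?\<mu> e f\<bar> = \<bar>M e * Z {} - M {} * Z e\<bar> / (Z {} * (Z {} + Z e))"
    using pos by (simp add: abs_mult)
  \<comment> \<open>Both the influence and the marginal difference of the expansion are governed by
    this determinant, with factors \<open>a * (1 - 2 * a)\<close> and \<open>a * (1 - a)\<close>.
    The former is the smaller one because 0 \<le> \<open>a\<close> \<le> 1/2.\<close>
  define d where "d = g (sym_diff {} f) * g e - g {} * g (sym_diff e f)"
  have Zg: "Z A = (1 - a) * g A + a * g (sym_diff A f)" for A
    unfolding Z_def g_def using fin assms(7-9)
    by (subst parity_sum_edge[of _ f]) (auto simp: a_def y_def z_def)
  have Ng: "N A f = a * g (sym_diff A f)" for A
    by (simp add: N_def edge_sum_def g_def a_def y_def)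
  have "M e * Z {} - M {} * Z e = - (a * (1 - 2 * a) * d)"
    unfolding Zg M_def d_def by (simp add: algebra_simps)
  moreover have "N {} f * Z e - N e f * Z {} = a * (1 - a) * d"
    unfolding Zg Ng d_def by (simp add: algebra_simps)
  moreover have "\<bar>a * (1 - 2 * a) * d\<bar> \<le> \<bar>a * (1 - a) * d\<bar>"
    using pf unfolding abs_mult by (intro mult_right_mono mult_left_mono) auto
  ultimately have "\<bar>M e * Z {} - M {} * Z e\<bar> \<le> \<bar>N {} f * Z e - N e f * Z {}\<bar>"
    by simp
  then show ?thesis
    unfolding infl using pos by (intro divide_right_mono) auto
qed

theorem lemma4p1:
  fixes V :: "'v set" and E :: "'v set set"
    and p :: "'v set \<Rightarrow> real" and lam :: "'v \<Rightarrow> real"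
  assumes "simple_graph V E"
    and "\<forall>e\<in>E. p e \<in> {0..1}"
    and "\<forall>v\<in>V. lam v \<in> {0..<1}"
  shows "spectrally_independent E (random_cluster V E p lam) (2 * (1 - Max (lam ` V)) powi (-2))"
proof -
  let ?\<mu> = "random_cluster V E p lam" and ?l = "Max (lam ` V)"
  have fin: "finite V" "finite E"
    using assms(1) simple_graph_finite_edges by (auto simp: simple_graph_def)
  have bound: "2 * (1 - ?l) powi (-2) = 2 * (1 / (1 - ?l))\<^sup>2"
    by (simp add: power_int_def power_inverse inverse_eq_divide power_one_over)
  have row: "(\<Sum>f\<in>E. \<bar>influence_matrix ?\<mu> e f\<bar>) \<le> 2 * (1 / (1 - ?l))\<^sup>2" if e: "e \<in> E" for e
  proof -
    have e2: "e \<subseteq> V" "card e = 2" using assms(1) e by (auto simp: simple_graph_def)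
    then have "V \<noteq> {}" by auto
    then have "?l \<in> lam ` V" using fin by (intro Max_in) auto
    then have l: "0 \<le> ?l" "?l < 1" using assms(3) by auto
    let ?\<eta> = "\<lambda>v. (1 - lam v) / (1 + lam v)" and ?y = "\<lambda>e. p e / 2" and ?z = "\<lambda>e. 1 - p e / 2"
    let ?Z = "parity_sum V ?y ?z ?\<eta> (E - {e})" and ?N = "edge_sum V ?y ?z ?\<eta> (E - {e})"
    have \<eta>: "0 < ?\<eta> v \<and> ?\<eta> v \<le> 1 \<and> 1 - ?\<eta> v \<le> ?l * (1 + ?\<eta> v)" if v: "v \<in> V" for v
    proof -
      have lv: "0 \<le> lam v" "lam v < 1" "lam v \<le> ?l" using v assms(3) fin by auto
      then have "1 - ?\<eta> v = lam v * (1 + ?\<eta> v)" "0 < ?\<eta> v" by (auto simp: field_simps)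
      moreover have "lam v * (1 + ?\<eta> v) \<le> ?l * (1 + ?\<eta> v)"
        using lv by (intro mult_right_mono) auto
      ultimately show ?thesis using lv by simp
    qed
    have yz: "0 \<le> ?y g \<and> 0 < ?z g" if "g \<in> E - {e}" for g
      using bspec[OF assms(2), of g] that by auto
    have G': "simple_graph V (E - {e})" using assms(1) by (auto simp: simple_graph_def)
    have pos: "0 < ?Z A" for A using fin yz \<eta> by (intro parity_sum_pos) auto
    have "(\<Sum>f\<in>E. \<bar>influence_matrix ?\<mu> e f\<bar>) = (\<Sum>f\<in>E - {e}. \<bar>influence_matrix ?\<mu> e f\<bar>)"
      using fin e by (subst sum.remove[of _ e]) (auto simp: influence_matrix_def)
    also have "\<dots> \<le> (\<Sum>f\<in>E - {e}. \<bar>?N {} f * ?Z e - ?N e f * ?Z {}\<bar> / (?Z {} * (?Z {} + ?Z e)))"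
      using e pos by (intro sum_mono influence_le_discrepancy assms) auto
    also have "\<dots> = discrepancy V ?y ?z ?\<eta> (E - {e}) {} e / (?Z {} * (?Z {} + ?Z e))"
      by (simp add: discrepancy_def sum_divide_distrib)
    also have "\<dots> \<le> 2 * (1 / (1 - ?l))\<^sup>2 * (?Z {} * ?Z e) / (?Z {} * (?Z {} + ?Z e))"
      using pos[of "{}"] pos[of e]
      by (intro divide_right_mono discrepancy_edge[OF G' l \<eta> yz e2]) auto
    \<comment> \<open>The remaining fraction is the share of the odd set \<open>e\<close> in the
      mixture obtained by conditioning on \<open>e\<close> being present.\<close>
    also have "\<dots> = 2 * (1 / (1 - ?l))\<^sup>2 * (?Z e / (?Z {} + ?Z e))"
      using pos[of "{}"] by simp
    also have "\<dots> \<le> 2 * (1 / (1 - ?l))\<^sup>2 * 1"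
      using pos[of "{}"] pos[of e] by (intro mult_left_mono) auto
    finally show ?thesis by simp
  qed
  \<comment> \<open>The inserted 0 is covered because the bound is twice a square; this also settles
    empty \<open>V\<close>, where \<open>Max\<close> is unspecified but there are no rows.\<close>
  show ?thesis
    unfolding spectrally_independent_def matrix_inf_norm_def bound
    using fin row by (subst Max_le_iff) auto
qed

end
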